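(* Let $X$ be a Hilbert space, $G:X\to X$ a $C^1$ smooth mapping, and $J:X\times X\to X$ satisfying that (i) $G$ is $C$-Lipschitz on $B(x_0,R)$; (ii) $\langle h,DG(x)(h)\rangle\le K<1$ for every $x\in B(x_0,R)$ and $\|h\|=1$; (iii) the mapping $J_y:X\to X$, $J_y(x)=J(x,y)$, is $L$-Lipschitz for all $y\in X$; (iv) the mapping $J_x:X\to X$, $J_x(y)=J(x,y)$, is differentiable, and $\|\frac{\partial J}{\partial y}(x,y)-I\|\le\varepsilon/C$ for every $x\in B(x_0,R)$ and $y\in G(B(x_0,R))$; (v) $L+K+\varepsilon<1$; and (vi) $\|J(x_0,G(x_0))-x_0\|<R(1-(L+K+\varepsilon))$. Then the mapping $F:X\to X$ defined by $F(x)=J(x,G(x))$ has a fixed point in the ball $B(x_0,R)$.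
   Context: $X$ is a real Hilbert space, $B(x_0,R)$ the open ball, $I$ the identity operator, and $\|\cdot\|$ on operators is the operator norm. *)

theory Defs
  imports "HOL-Analysis.Analysis"
begin

end

theory Submission
  imports Defs
begin

text \<open>
  Write \<open>F x = J (x, G x)\<close>, let \<open>m = 1 - (L + K + \<epsilon>) > 0\<close>, and consider the displacement
  \<open>\<Phi> x = norm (F x - x)\<close> on the ball. Under the numerical-range bound \<open>K\<close>, the map \<open>F\<close> need not
  be a contraction: \<open>G\<close> may stretch by any factor \<open>C\<close> in directions orthogonal to the increment.
  What survives is that \<open>\<Phi>\<close> decreases to first order when \<open>x\<close> moves towards its own image.

  Put \<open>h = F x - x\<close> and \<open>z = x + t h\<close>. The displacement at \<open>z\<close> is
  \<open>h + (G z - G x) - t h\<close> up to an error of norm at most \<open>(L + \<epsilon>) t \<parallel>h\<parallel>\<close>: the term \<open>L\<close> comes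
  from the first argument of \<open>J\<close>, and \<open>\<epsilon>\<close> from the map \<open>y \<mapsto> J (x, G y) - G y\<close>, whose
  derivative \<open>(DJ - I) \<circ> DG\<close> has norm at most \<open>(\<epsilon> / C) C\<close>. Because the norm of an inner product
  space is differentiable off the origin with gradient \<open>h / \<parallel>h\<parallel>\<close>, the norm of
  \<open>h + (G z - G x) - t h\<close> has right derivative at most \<open>(K - 1) \<parallel>h\<parallel>\<close> in \<open>t\<close>; only the component
  of \<open>DG x h\<close> along \<open>h\<close> matters, which is exactly what \<open>K\<close> controls. Hence, for every
  \<open>m' < m\<close>, some arbitrarily small step decreases \<open>\<Phi>\<close> by more than \<open>m'\<close> times its length
  (\<open>displacement_decrease\<close>).

  Ekeland's variational principle turns this infinitesimal statement into a global one. Since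
  \<open>\<Phi> x0 < R m\<close>, there are \<open>m' < m\<close> and \<open>r < R\<close> with \<open>\<Phi> x0 < r m'\<close>. The principle on the closed
  ball of radius \<open>r\<close> yields a point at distance less than \<open>r\<close> from \<open>x0\<close> from which no step
  decreases \<open>\<Phi>\<close> at rate \<open>m'\<close>. By the previous paragraph the displacement there vanishes.
\<close>

section \<open>Ekeland's variational principle\<close>

text \<open>
  The sets \<open>T x\<close> of points reachable from \<open>x\<close> with a descent of rate \<open>m\<close> are closed, and
  \<open>z \<in> T x\<close> implies \<open>T z \<subseteq> T x\<close> by the triangle inequality. Choosing successively almost minimal
  points of \<open>f\<close> in these sets makes their diameters shrink to zero, so completeness gives a point
  \<open>a\<close> in all of them; \<open>T a\<close> then cannot contain any other point.
\<close>

lemma ekeland_variational_principle: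
  fixes f :: "'a::complete_space \<Rightarrow> real"
  assumes S: "closed S" "x0 \<in> S"
    and cont: "continuous_on S f"
    and bdd: "bdd_below (f ` S)"
    and m: "m > 0"
  obtains a where "a \<in> S" "f a + m * dist x0 a \<le> f x0"
    "\<And>z. z \<in> S \<Longrightarrow> z \<noteq> a \<Longrightarrow> f a < f z + m * dist a z"
proof -
  define T where "T x = {z \<in> S. f z + m * dist x z \<le> f x}" for x
  have T_self: "x \<in> T x" if "x \<in> S" for x
    using that by (simp add: T_def)
  have T_trans: "T z \<subseteq> T x" if "z \<in> T x" for x z
  proof
    fix w assume w: "w \<in> T z"
    have "m * dist x w \<le> m * (dist x z + dist z w)"
      using m by (intro mult_left_mono dist_triangle) auto
    then show "w \<in> T x"
      using that w by (simp add: T_def algebra_simps)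
  qed
  have T_closed: "closed (T x)" for x
    unfolding T_def by (intro continuous_on_closed_Collect_le continuous_intros cont S)
  have almost_min: "\<exists>y. y \<in> T x \<and> (\<forall>w\<in>T x. f y < f w + \<delta>)" if x: "x \<in> S" and \<delta>: "\<delta> > 0" for x \<delta>
  proof -
    have bd: "bdd_below (f ` T x)"
      using bdd by (rule bdd_below_mono) (auto simp: T_def)
    have ne: "f ` T x \<noteq> {}"
      using T_self[OF x] by blast
    obtain y where "y \<in> T x" "f y < Inf (f ` T x) + \<delta>"
      using cInf_lessD[OF ne, of "Inf (f ` T x) + \<delta>"] \<delta> by auto
    moreover have "Inf (f ` T x) \<le> f w" if "w \<in> T x" for w
      using that bd by (intro cInf_lower) auto
    ultimately show ?thesis
      by (smt (verit))
  qed
  define Q where "Q n x y \<longleftrightarrow> y \<in> T x \<and> (\<forall>w\<in>T x. f y < f w + inverse (real (Suc n)))"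
    for n x y
  have "\<exists>X. \<forall>n. (X n \<in> S \<and> (n = 0 \<longrightarrow> X n = x0)) \<and> Q n (X n) (X (Suc n))"
  proof (rule dependent_nat_choice)
    show "\<exists>x. x \<in> S \<and> (0 = (0::nat) \<longrightarrow> x = x0)"
      using S by auto
    show "\<exists>y. (y \<in> S \<and> (Suc n = 0 \<longrightarrow> y = x0)) \<and> Q n x y"
      if "x \<in> S \<and> (n = 0 \<longrightarrow> x = x0)" for x n
      using almost_min[of x "inverse (real (Suc n))"] that by (auto simp: Q_def T_def)
  qed
  then obtain X where X: "\<And>n. X n \<in> S" "X 0 = x0" "\<And>n. Q n (X n) (X (Suc n))"
    by blast
  have step: "T (X (Suc n)) \<subseteq> T (X n)" for n
    using X(3)[of n] T_trans by (auto simp: Q_def)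
  have anti: "T (X n) \<subseteq> T (X k)" if "k \<le> n" for k n
    using that step by (rule lift_Suc_antimono_le[rotated])
  have near: "m * dist (X (Suc n)) w < inverse (real (Suc n))" if "w \<in> T (X (Suc n))" for n w
  proof -
    have "f (X (Suc n)) < f w + inverse (real (Suc n))"
      using X(3)[of n] that step by (auto simp: Q_def)
    then show ?thesis
      using that by (auto simp: T_def)
  qed
  have "\<exists>a. \<Inter>(range (\<lambda>n. T (X n))) = {a}"
  proof (rule decreasing_closed_nest_sing)
    fix e :: real assume e: "e > 0"
    obtain n where n: "inverse (real (Suc n)) < m * e / 2"
      using reals_Archimedean[of "m * e / 2"] m e by auto
    have half: "dist (X (Suc n)) w < e / 2" if "w \<in> T (X (Suc n))" for w
    proof -
      have "m * dist (X (Suc n)) w < m * (e / 2)"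
        using near[OF that] n by simp
      then show ?thesis
        using m mult_less_cancel_left_pos by blast
    qed
    have "dist x y < e" if "x \<in> T (X (Suc n))" "y \<in> T (X (Suc n))" for x y
      using half[OF that(1)] half[OF that(2)] dist_triangle_half_r by blast
    then show "\<exists>n. \<forall>x\<in>T (X n). \<forall>y\<in>T (X n). dist x y < e"
      by blast
  qed (use T_closed T_self[OF X(1)] anti in blast)+
  then obtain a where a: "\<Inter>(range (\<lambda>n. T (X n))) = {a}" ..
  then have aT: "a \<in> T (X n)" for n
    by blast
  have "a \<in> S" "f a + m * dist x0 a \<le> f x0"
    using aT[of 0] X(2) by (auto simp: T_def)
  moreover have "f a < f z + m * dist a z" if "z \<in> S" "z \<noteq> a" for z
  proof (rule ccontr)
    assume "\<not> ?thesis"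
    then have "z \<in> T a"
      using that by (simp add: T_def)
    then have "z \<in> \<Inter>(range (\<lambda>n. T (X n)))"
      using T_trans[OF aT] by blast
    then show False
      using a that by simp
  qed
  ultimately show thesis
    using that by blast
qed

section \<open>Derivative estimates\<close>

lemma lipschitz_on_imp_norm_derivative_le:
  fixes f :: "'a::real_normed_vector \<Rightarrow> 'b::real_normed_vector"
  assumes lip: "C-lipschitz_on S f" and S: "open S" "x \<in> S"
    and der: "(f has_derivative f') (at x)"
  shows "norm (f' v) \<le> C * norm v"
proof (cases "v = 0")
  case True
  then show ?thesis
    using linear_0[OF has_derivative_linear[OF der]] by simp
next
  case False
  have approx: "norm (f' v) \<le> (C + e) * norm v" if "e > 0" for e
  proof -
    obtain d where d: "d > 0"
      "\<And>y. norm (y - x) < d \<Longrightarrow> norm (f y - f x - f' (y - x)) \<le> e * norm (y - x)"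
      using der \<open>e > 0\<close> unfolding has_derivative_at_alt by blast
    obtain r where r: "r > 0" "ball x r \<subseteq> S"
      using S by (meson open_contains_ball)
    define t where "t = min d r / (2 * norm v)"
    have t: "t > 0" "t * norm v < d" "t * norm v < r"
      using d r False by (auto simp: t_def)
    have "norm (f (x + t *\<^sub>R v) - f x) \<le> C * (t * norm v)"
      using lipschitz_onD[OF lip, of "x + t *\<^sub>R v" x] r t S
      by (auto simp: dist_norm subset_iff)
    moreover have "norm (f (x + t *\<^sub>R v) - f x - t *\<^sub>R f' v) \<le> e * (t * norm v)"
      using d(2)[of "x + t *\<^sub>R v"] t linear_cmul[OF has_derivative_linear[OF der]] by simp
    ultimately have "norm (t *\<^sub>R f' v) \<le> C * (t * norm v) + e * (t * norm v)"
      using norm_triangle_ineq4[of "f (x + t *\<^sub>R v) - f x" "f (x + t *\<^sub>R v) - f x - t *\<^sub>R f' v"]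
      by simp
    then have "t * norm (f' v) \<le> t * ((C + e) * norm v)"
      using t(1) by (simp add: algebra_simps)
    then show ?thesis
      using t(1) by simp
  qed
  have "norm (f' v) \<le> C * norm v + \<delta>" if "\<delta> > 0" for \<delta>
    using approx[of "\<delta> / norm v"] that False by (simp add: algebra_simps)
  then show ?thesis
    by (rule field_le_epsilon)
qed

text \<open>
  The first-order expansion of the norm: the gradient of the norm at \<open>h\<close> is the unit vector in
  direction \<open>h\<close>, so only \<open>h \<bullet> g'\<close> enters the rate of change of \<open>norm (h + g t)\<close>. The strict bound
  \<open>c\<close> on this rate absorbs the higher-order terms for small \<open>t\<close>.
\<close>

lemma norm_add_curve_less:
  fixes g :: "real \<Rightarrow> 'a::real_inner"
  assumes der: "(g has_vector_derivative g') (at 0)" and g0: "g 0 = 0"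
    and h: "h \<noteq> 0" and rate: "h \<bullet> g' < c * norm h"
  obtains d where "d > 0" "\<And>t. 0 < t \<Longrightarrow> t < d \<Longrightarrow> norm (h + g t) < norm h + c * t"
proof -
  have g_der: "((\<lambda>t. h + g t) has_derivative (\<lambda>t. t *\<^sub>R g')) (at 0)"
    using der unfolding has_vector_derivative_def by (auto intro!: derivative_eq_intros)
  have norm_der: "(norm has_derivative (\<lambda>v. v \<bullet> sgn h)) (at (h + g 0))"
    using has_derivative_norm[OF h] by (simp add: g0)
  have "((\<lambda>t. norm (h + g t)) has_real_derivative (g' \<bullet> sgn h)) (at 0)"
    using has_derivative_compose[OF g_der norm_der]
    by (rule has_derivative_imp_has_field_derivative) simp
  then have "((\<lambda>t. norm (h + g t) - c * t) has_real_derivative (g' \<bullet> sgn h - c)) (at 0)"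
    by (auto intro!: derivative_eq_intros)
  moreover have "g' \<bullet> sgn h - c < 0"
    using rate h by (simp add: sgn_div_norm inner_commute field_simps)
  ultimately obtain d where "d > 0"
    "\<And>t. 0 < t \<Longrightarrow> t < d \<Longrightarrow> norm (h + g 0) - c * 0 > norm (h + g (0 + t)) - c * (0 + t)"
    using DERIV_neg_dec_right by blast
  then show thesis
    using that by (simp add: g0 algebra_simps)
qed

text \<open>
  The set \<open>G ` ball x0 R\<close> need not be convex, so \<open>J (x, \<cdot>) - I\<close> itself may fail to be
  \<open>\<epsilon> / C\<close>-Lipschitz on it. The mean value inequality is therefore applied after pulling back along \<open>G\<close> to the convex
  domain \<open>S\<close>.
\<close>

lemma lipschitz_near_identity_compose:
  fixes G :: "'a::real_normed_vector \<Rightarrow> 'b::real_normed_vector"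
  assumes S: "convex S" "open S"
    and G_deriv: "\<And>y. y \<in> S \<Longrightarrow> (G has_derivative blinfun_apply (DG y)) (at y)"
    and C: "C > 0" and G_lip: "C-lipschitz_on S G"
    and H_deriv: "\<And>y. y \<in> S \<Longrightarrow> (H has_derivative blinfun_apply (DH (G y))) (at (G y))"
    and near_id: "\<And>y. y \<in> S \<Longrightarrow> norm (DH (G y) - id_blinfun) \<le> \<epsilon> / C"
    and xy: "x \<in> S" "y \<in> S"
  shows "norm ((H (G x) - G x) - (H (G y) - G y)) \<le> \<epsilon> * norm (x - y)"
proof (rule differentiable_bound[OF S(1) _ _ xy])
  fix z assume z: "z \<in> S"
  let ?D = "\<lambda>v. blinfun_apply (DH (G z)) (blinfun_apply (DG z) v) - blinfun_apply (DG z) v"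
  have "((\<lambda>y. H (G y) - G y) has_derivative ?D) (at z)"
    by (intro has_derivative_diff has_derivative_compose[OF G_deriv H_deriv] G_deriv z)
  then show "((\<lambda>y. H (G y) - G y) has_derivative ?D) (at z within S)"
    by (rule has_derivative_at_withinI)
  have \<epsilon>: "0 \<le> \<epsilon>"
    using order_trans[OF norm_ge_zero near_id[OF z]] C by (simp add: zero_le_divide_iff)
  show "onorm ?D \<le> \<epsilon>"
  proof (rule onorm_bound[OF \<epsilon>])
    fix v
    have "norm (?D v) = norm (blinfun_apply (DH (G z) - id_blinfun) (blinfun_apply (DG z) v))"
      by (simp add: blinfun.diff_left)
    also have "\<dots> \<le> norm (DH (G z) - id_blinfun) * norm (blinfun_apply (DG z) v)"
      by (rule norm_blinfun)
    also have "\<dots> \<le> (\<epsilon> / C) * (C * norm v)"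
      using near_id[OF z] lipschitz_on_imp_norm_derivative_le[OF G_lip S(2) z G_deriv[OF z]] \<epsilon> C
      by (intro mult_mono) auto
    also have "\<dots> = \<epsilon> * norm v"
      using C by simp
    finally show "norm (?D v) \<le> \<epsilon> * norm v" .
  qed
qed

section \<open>Descent of the displacement\<close>

text \<open>
  The hypothesis \<open>approx\<close> compares the increments of \<open>F\<close> with those of \<open>G\<close>; it is how all
  information about \<open>J\<close> enters. The rate \<open>m\<close> is the part of \<open>1 - K\<close> that remains after the error
  \<open>\<eta>\<close> is paid, less an arbitrarily small amount.
\<close>

lemma displacement_decrease:
  fixes F G :: "'a::real_inner \<Rightarrow> 'a"
  assumes S: "open S" "x \<in> S"
    and G_deriv: "(G has_derivative G') (at x)"
    and num: "\<And>v. norm v = 1 \<Longrightarrow> v \<bullet> G' v \<le> K"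
    and approx: "\<And>z. z \<in> S \<Longrightarrow> norm ((F z - F x) - (G z - G x)) \<le> \<eta> * norm (z - x)"
    and m: "m < 1 - (K + \<eta>)" and nonfix: "F x \<noteq> x"
  obtains z where "z \<in> S" "z \<noteq> x" "norm (F z - z) + m * dist x z < norm (F x - x)"
proof -
  define h where "h = F x - x"
  have h: "h \<noteq> 0"
    using nonfix by (simp add: h_def)
  define g where "g t = (G (x + t *\<^sub>R h) - G x) - t *\<^sub>R h" for t
  have lin: "linear G'"
    using G_deriv by (rule has_derivative_linear)
  have line: "((\<lambda>t. x + t *\<^sub>R h) has_derivative (\<lambda>t. t *\<^sub>R h)) (at 0)"
    by (auto intro!: derivative_eq_intros)
  have "((\<lambda>t. G (x + t *\<^sub>R h)) has_derivative (\<lambda>t. G' (t *\<^sub>R h))) (at 0)"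
    using has_derivative_compose[OF line] G_deriv by simp
  then have g_der: "(g has_vector_derivative (G' h - h)) (at 0)"
    unfolding g_def has_vector_derivative_def
    by (auto intro!: derivative_eq_intros simp: linear_cmul[OF lin] algebra_simps)
  have hG: "h \<bullet> G' h \<le> K * (norm h)\<^sup>2"
  proof -
    have "sgn h \<bullet> G' (sgn h) \<le> K"
      using h by (intro num) (simp add: norm_sgn)
    then show ?thesis
      using h by (simp add: sgn_div_norm linear_cmul[OF lin] field_simps power2_eq_square)
  qed
  have "h \<bullet> (G' h - h) \<le> (K - 1) * (norm h)\<^sup>2"
    using hG by (simp add: inner_diff_right power2_norm_eq_inner algebra_simps)
  also have "\<dots> < - (m + \<eta>) * (norm h)\<^sup>2"
    using m h by (intro mult_strict_right_mono) auto
  also have "\<dots> = (- (m + \<eta>) * norm h) * norm h"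
    by (simp add: power2_eq_square)
  finally have rate: "h \<bullet> (G' h - h) < (- (m + \<eta>) * norm h) * norm h" .
  obtain d where d: "d > 0"
    "\<And>t. 0 < t \<Longrightarrow> t < d \<Longrightarrow> norm (h + g t) < norm h + (- (m + \<eta>) * norm h) * t"
    using norm_add_curve_less[OF g_der _ h rate] by (auto simp: g_def)
  obtain r where r: "r > 0" "ball x r \<subseteq> S"
    using S by (meson open_contains_ball)
  define t where "t = min d (r / norm h) / 2"
  have t: "0 < t" "t < d" "t * norm h < r"
    using d r h by (auto simp: t_def min_def field_simps)
  define z where "z = x + t *\<^sub>R h"
  have zS: "z \<in> S"
    using r t by (auto simp: z_def dist_norm subset_iff)
  have dz: "norm (z - x) = t * norm h"
    using t by (simp add: z_def)
  have "F z - z = (h + g t) + ((F z - F x) - (G z - G x))"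
    by (simp add: g_def z_def h_def)
  then have "norm (F z - z) \<le> norm (h + g t) + norm ((F z - F x) - (G z - G x))"
    using norm_triangle_ineq by metis
  also have "\<dots> < norm h + (- (m + \<eta>) * norm h) * t + \<eta> * (t * norm h)"
    using d(2)[OF t(1,2)] approx[OF zS] dz by simp
  finally have "norm (F z - z) + m * dist x z < norm (F x - x)"
    using dz by (simp add: dist_norm norm_minus_commute h_def algebra_simps)
  moreover have "z \<noteq> x"
    using t h by (simp add: z_def)
  ultimately show thesis
    using zS that by blast
qed

section \<open>The fixed point theorem\<close>

text \<open>
  At interior points of the closed ball, a step that decreases the displacement at rate \<open>m'\<close> can be
  taken inside the ball, which contradicts the extremality of the Ekeland point. The gap between
  \<open>\<Phi> x0\<close> and \<open>R * m\<close> is spent twice: on a rate \<open>m' < m\<close>, as needed for the strict descent, and on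
  a radius \<open>r < R\<close>, as needed for a closed domain.
\<close>

theorem theorem40:
  fixes G :: "'a::{real_inner, banach} \<Rightarrow> 'a"
    and DG :: "'a \<Rightarrow> 'a \<Rightarrow>\<^sub>L 'a"
    and J :: "'a \<times> 'a \<Rightarrow> 'a"
    and DJ :: "'a \<Rightarrow> 'a \<Rightarrow> 'a \<Rightarrow>\<^sub>L 'a"
    and x0 :: 'a
    and R C K L \<epsilon> :: real
  assumes G_deriv: "\<And>x. (G has_derivative blinfun_apply (DG x)) (at x)"
    and G_C1: "continuous_on UNIV DG"
    and C_pos: "C > 0"
    and G_lip: "C-lipschitz_on (ball x0 R) G"
    and G_num: "\<And>x h. x \<in> ball x0 R \<Longrightarrow> norm h = 1 \<Longrightarrow> h \<bullet> blinfun_apply (DG x) h \<le> K"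
    and K_less: "K < 1"
    and J_lip: "\<And>y. L-lipschitz_on UNIV (\<lambda>x. J (x, y))"
    and J_deriv: "\<And>x y. x \<in> ball x0 R \<Longrightarrow>
          ((\<lambda>z. J (x, z)) has_derivative blinfun_apply (DJ x y)) (at y)"
    and J_near_id: "\<And>x y. x \<in> ball x0 R \<Longrightarrow> y \<in> G ` ball x0 R \<Longrightarrow>
          norm (DJ x y - id_blinfun) \<le> \<epsilon> / C"
    and sum_less: "L + K + \<epsilon> < 1"
    and start: "norm (J (x0, G x0) - x0) < R * (1 - (L + K + \<epsilon>))"
  shows "\<exists>x \<in> ball x0 R. J (x, G x) = x"
proof -
  define F where "F x = J (x, G x)" for x
  define \<Phi> where "\<Phi> x = norm (F x - x)" for x
  define m where "m = 1 - (L + K + \<epsilon>)"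
  have m: "m > 0"
    using sum_less by (simp add: m_def)
  have \<Phi>0: "\<Phi> x0 < R * m"
    using start by (simp add: \<Phi>_def F_def m_def)
  then have R: "R > 0"
    using m zero_less_mult_pos2[of R m] norm_ge_zero[of "F x0 - x0"] unfolding \<Phi>_def by linarith
  have approx: "norm ((F z - F x) - (G z - G x)) \<le> (L + \<epsilon>) * norm (z - x)"
    if x: "x \<in> ball x0 R" and z: "z \<in> ball x0 R" for x z
  proof -
    have first: "norm (F z - J (x, G z)) \<le> L * norm (z - x)"
      using lipschitz_onD[OF J_lip, of z x "G z"] by (simp add: F_def dist_norm)
    have second: "norm ((J (x, G z) - G z) - (J (x, G x) - G x)) \<le> \<epsilon> * norm (z - x)"
      by (rule lipschitz_near_identity_compose[where S = "ball x0 R" and H = "\<lambda>y. J (x, y)"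
            and DH = "DJ x"])
        (use G_deriv C_pos G_lip J_deriv[OF x] J_near_id[OF x] x z in auto)
    have "(F z - F x) - (G z - G x)
        = (F z - J (x, G z)) + ((J (x, G z) - G z) - (J (x, G x) - G x))"
      by (simp add: F_def)
    then have "norm ((F z - F x) - (G z - G x)) \<le> L * norm (z - x) + \<epsilon> * norm (z - x)"
      using norm_triangle_mono[OF first second] by metis
    then show ?thesis
      by (simp add: algebra_simps)
  qed
  have F_cont: "continuous_on (ball x0 R) F"
  proof (rule lipschitz_on_continuous_on)
    have \<epsilon>: "0 \<le> \<epsilon>"
      using order_trans[OF norm_ge_zero J_near_id[of x0 "G x0"]] C_pos R
      by (simp add: zero_le_divide_iff)
    show "(C + (L + \<epsilon>))-lipschitz_on (ball x0 R) F"
    proof (rule lipschitz_onI)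
      fix x y assume xy: "x \<in> ball x0 R" "y \<in> ball x0 R"
      have "norm (F x - F y) \<le> norm (G x - G y) + norm ((F x - F y) - (G x - G y))"
        using norm_triangle_sub by blast
      also have "\<dots> \<le> C * norm (x - y) + (L + \<epsilon>) * norm (x - y)"
        using lipschitz_onD[OF G_lip xy] approx[OF xy(2,1)] by (simp add: dist_norm)
      finally show "dist (F x) (F y) \<le> (C + (L + \<epsilon>)) * dist x y"
        by (simp add: dist_norm algebra_simps)
    next
      show "0 \<le> C + (L + \<epsilon>)"
        using C_pos \<epsilon> lipschitz_on_nonneg[OF J_lip] by simp
    qed
  qed
  have "\<Phi> x0 / R < m"
    using \<Phi>0 R by (simp add: field_simps)
  then obtain m' where m': "\<Phi> x0 / R < m'" "m' < m"
    using dense by blast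
  have "0 \<le> \<Phi> x0 / R"
    using R by (simp add: \<Phi>_def)
  with m' have m'_pos: "m' > 0"
    by linarith
  have "\<Phi> x0 / m' < R"
    using m' m'_pos R by (simp add: field_simps)
  then obtain r where r: "\<Phi> x0 / m' < r" "r < R"
    using dense by blast
  have r_pos: "r > 0"
    using r(1) m'_pos by (smt (verit) \<Phi>_def divide_nonneg_pos norm_ge_zero)
  have sub: "cball x0 r \<subseteq> ball x0 R"
    using r(2) by auto
  have \<Phi>_cont: "continuous_on (cball x0 r) \<Phi>"
    unfolding \<Phi>_def
    by (intro continuous_intros continuous_on_subset[OF F_cont sub])
  have "bdd_below (\<Phi> ` cball x0 r)"
    by (rule bdd_belowI[of _ 0]) (auto simp: \<Phi>_def)
  then obtain a where a: "a \<in> cball x0 r" "\<Phi> a + m' * dist x0 a \<le> \<Phi> x0"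
    "\<And>z. z \<in> cball x0 r \<Longrightarrow> z \<noteq> a \<Longrightarrow> \<Phi> a < \<Phi> z + m' * dist a z"
    using ekeland_variational_principle[OF closed_cball _ \<Phi>_cont _ m'_pos, of x0] r_pos by auto
  have "m' * dist x0 a \<le> \<Phi> x0"
    using a(2) by (smt (verit) \<Phi>_def norm_ge_zero)
  also have "\<dots> < m' * r"
    using r(1) m'_pos by (simp add: field_simps)
  finally have a_ball: "a \<in> ball x0 r"
    using m'_pos by simp
  have aR: "a \<in> ball x0 R"
    using a(1) sub by blast
  have "F a = a"
  proof (rule ccontr)
    assume "F a \<noteq> a"
    moreover have "m' < 1 - (K + (L + \<epsilon>))"
      using m'(2) by (simp add: m_def)
    moreover have "norm ((F z - F a) - (G z - G a)) \<le> (L + \<epsilon>) * norm (z - a)"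
      if "z \<in> ball x0 r" for z
      using approx[OF aR] that r(2) by simp
    ultimately obtain z where z: "z \<in> ball x0 r" "z \<noteq> a" "\<Phi> z + m' * dist a z < \<Phi> a"
      using displacement_decrease[OF open_ball a_ball G_deriv G_num[OF aR]] unfolding \<Phi>_def by metis
    then show False
      using a(3)[of z] by simp
  qed
  then show ?thesis
    using aR unfolding F_def by blast
qed

end
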